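(* If $n\geq2$ and $k\geq5$ then there exists an $\mathcal{OS}_k(n)$ (a $k$-ary orientable sequence of order $n$) with period \[k^{n-1}\left\lfloor\frac{k-1}{2}\right\rfloor.\]
   Context: For an infinite periodic sequence $S=(s_i)$ with elements in $\mathbb{Z}_k$, write $\mathbf{s}_n(i)=(s_i,s_{i+1},\ldots,s_{i+n-1})$. For an $n$-tuple $\mathbf{u}=(u_0,\ldots,u_{n-1})$ its reverse is $\mathbf{u}^R=(u_{n-1},\ldots,u_0)$. $S$, of period $m$, is a $k$-ary $n$-window sequence if $\mathbf{s}_n(i)=\mathbf{s}_n(j)$ implies $i\equiv j \pmod m$. A $k$-ary $n$-window sequence $S$ is an orientable sequence of order $n$, an $\mathcal{OS}_k(n)$, if $\mathbf{s}_n(i)\neq \mathbf{s}_n(j)^R$ for all $i,j$ (including $i=j$). *)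

theory Defs
  imports "HOL-Number_Theory.Cong"
begin

text \<open>
  A sequence over $\mathbb{Z}_k$ is a function on \<^typ>\<open>nat\<close> whose values are the canonical
  residues $0, \ldots, k-1$; an $n$-tuple is a list of length $n$, and its reverse is \<^const>\<open>rev\<close>.
\<close>

definition window :: "(nat \<Rightarrow> 'a) \<Rightarrow> nat \<Rightarrow> nat \<Rightarrow> 'a list" where
  "window s n i = map s [i..<i + n]"

definition periodic_with :: "(nat \<Rightarrow> 'a) \<Rightarrow> nat \<Rightarrow> bool" where
  "periodic_with s m \<longleftrightarrow> m > 0 \<and> (\<forall>i. s (i + m) = s i)"

text \<open>
  Minimality of the period need not be demanded: if $d > 0$ is a period of $s$, then the windows at
  $0$ and $d$ agree, so the window condition yields $m \mid d$. Hence $m$ is the least period.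
\<close>

definition window_sequence :: "nat \<Rightarrow> nat \<Rightarrow> nat \<Rightarrow> (nat \<Rightarrow> nat) \<Rightarrow> bool" where
  "window_sequence k n m s \<longleftrightarrow>
     (\<forall>i. s i < k) \<and> periodic_with s m \<and>
     (\<forall>i j. window s n i = window s n j \<longrightarrow> [i = j] (mod m))"

definition orientable_sequence :: "nat \<Rightarrow> nat \<Rightarrow> nat \<Rightarrow> (nat \<Rightarrow> nat) \<Rightarrow> bool" where
  "orientable_sequence k n m s \<longleftrightarrow>
     window_sequence k n m s \<and> (\<forall>i j. window s n i \<noteq> rev (window s n j))"

end

theory Submission
  imports Defs "Graph_Theory.Euler"
begin

text \<open>
  Put $h = \lfloor (k-1)/2 \rfloor$ and say that $y$ is a forward step from $x$ in $\mathbb{Z}_k$ if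
  $y - x \in \{1, \ldots, h\}$. Since $2h < k$, undoing a forward step is never a forward step.
  Hence, if every window of a sequence has its last entry a forward step from its first, then no
  window is the reverse of a window. There are exactly $k^{n-1} h$ such $n$-tuples, so it
  suffices to arrange all of them, once each, as the windows of one period.

  As in the classical construction of de Bruijn sequences, this is an Euler circuit problem. The
  vertices are the $(n-1)$-tuples, and an admissible $n$-tuple is an arc from its first
  $n-1$ entries to its last $n-1$ entries. An arc out of a vertex is a forward step from the first
  entry of the vertex and an arc into it is a forward step to the last entry, so all in-degrees and
  out-degrees equal $h$.

  It remains to see that the digraph is connected. Traversing $n-1$ arcs replaces the entries of a
  vertex one after the other, each by an arbitrary forward step from itself
  (\<open>tuple_digraph_replace_prefix\<close>). After $t$ such rounds the entries have been changed by
  independent chains of $t$ forward steps. The number $t$ of rounds is common to all entries, so a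
  single $t$ has to serve for all pairs of residues; as $h \ge 2$, the choice $t = k$ does, because
  $k$ steps of length 1 or 2 cover every total from $k$ to $2k$ (\<open>forward_step_power_total\<close>).
  This is where $k \ge 5$ enters.

  Only three properties of forward steps matter here: asymmetry, regularity of degree $h$, and the
  existence of a $t$ for which chains of length $t$ join every pair of points. The graph-theoretic
  part is therefore carried out for an arbitrary relation \<open>R\<close> with these properties.
\<close>

section \<open>Digraphs on tuples\<close>

text \<open>
  If \<open>R\<close> holds everywhere on \<open>A\<close>, this is the de Bruijn digraph. Arcs are the tuples themselves
  and not pairs of vertices: an Euler circuit is then directly a list of the windows sought, in
  their cyclic order.
\<close>

definition tuple_digraph ::
  "'a set \<Rightarrow> ('a \<Rightarrow> 'a \<Rightarrow> bool) \<Rightarrow> nat \<Rightarrow> ('a list, 'a list) pre_digraph" where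
  "tuple_digraph A R N =
     \<lparr> verts = {w \<in> lists A. length w = N},
       arcs = {u \<in> lists A. length u = Suc N \<and> R (hd u) (last u)},
       tail = butlast, head = tl \<rparr>"

lemma tuple_digraph_simps [simp]:
  "verts (tuple_digraph A R N) = {w \<in> lists A. length w = N}"
  "arcs (tuple_digraph A R N) = {u \<in> lists A. length u = Suc N \<and> R (hd u) (last u)}"
  "tail (tuple_digraph A R N) = butlast"
  "head (tuple_digraph A R N) = tl"
  by (simp_all add: tuple_digraph_def)

lemma wf_tuple_digraph: "wf_digraph (tuple_digraph A R N)"
  by unfold_locales (auto dest: in_set_butlastD list.set_sel(2)[rotated])

lemma finite_lists_of_length: "finite A \<Longrightarrow> finite {w \<in> lists A. length w = N}"
  using finite_lists_length_eq[of A N] by (simp add: lists_eq_set)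

lemma fin_tuple_digraph:
  assumes "finite A"
  shows "fin_digraph (tuple_digraph A R N)"
proof -
  interpret wf_digraph "tuple_digraph A R N" by (rule wf_tuple_digraph)
  show ?thesis
  proof (rule fin_digraphI)
    show "finite (verts (tuple_digraph A R N))"
      using finite_lists_of_length[OF assms] by simp
    show "finite (arcs (tuple_digraph A R N))"
      using finite_lists_of_length[OF assms, of "Suc N"] by (auto elim: rev_finite_subset)
  qed
qed

lemma out_arcs_tuple_digraph:
  assumes "w \<in> lists A" and "length w = N" and "N > 0" and "\<And>x y. R x y \<Longrightarrow> y \<in> A"
  shows "out_arcs (tuple_digraph A R N) w = (\<lambda>b. w @ [b]) ` {b. R (hd w) b}"
proof (intro equalityI subsetI)
  fix u assume "u \<in> out_arcs (tuple_digraph A R N) w"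
  then have u: "butlast u = w" "length u = Suc N" "R (hd u) (last u)"
    by (auto simp: out_arcs_def)
  then have "u = w @ [last u]" by (metis append_butlast_last_id list.size(3) nat.distinct(1))
  moreover from this have "hd u = hd w"
    using assms(2,3) by (metis hd_append2 length_greater_0_conv)
  ultimately show "u \<in> (\<lambda>b. w @ [b]) ` {b. R (hd w) b}" using u by auto
next
  fix u assume "u \<in> (\<lambda>b. w @ [b]) ` {b. R (hd w) b}"
  then show "u \<in> out_arcs (tuple_digraph A R N) w"
    using assms by (auto simp: out_arcs_def hd_append)
qed

lemma in_arcs_tuple_digraph:
  assumes "w \<in> lists A" and "length w = N" and "N > 0" and "\<And>x y. R x y \<Longrightarrow> x \<in> A"
  shows "in_arcs (tuple_digraph A R N) w = (\<lambda>a. a # w) ` {a. R a (last w)}"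
proof (intro equalityI subsetI)
  fix u assume "u \<in> in_arcs (tuple_digraph A R N) w"
  then have "tl u = w" "length u = Suc N" "R (hd u) (last u)"
    by (auto simp: in_arcs_def)
  then show "u \<in> (\<lambda>a. a # w) ` {a. R a (last w)}"
    using assms(2,3) by (cases u) auto
next
  fix u assume "u \<in> (\<lambda>a. a # w) ` {a. R a (last w)}"
  then show "u \<in> in_arcs (tuple_digraph A R N) w"
    using assms by (auto simp: in_arcs_def)
qed

lemma card_arcs_tuple_digraph:
  assumes "finite A" and "N > 0" and "\<And>x y. R x y \<Longrightarrow> y \<in> A"
    and "\<And>x. x \<in> A \<Longrightarrow> card {y. R x y} = h"
  shows "card (arcs (tuple_digraph A R N)) = card A ^ N * h"
proof -
  let ?G = "tuple_digraph A R N"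
  interpret fin_digraph ?G by (rule fin_tuple_digraph[OF assms(1)])
  have "arcs ?G = (\<Union>w\<in>verts ?G. out_arcs ?G w)"
    using tail_in_verts by (auto simp: out_arcs_def simp del: tuple_digraph_simps)
  also have "card \<dots> = (\<Sum>w\<in>verts ?G. card (out_arcs ?G w))"
    by (rule card_UN_disjoint) (auto simp: out_arcs_def simp del: tuple_digraph_simps)
  also have "\<dots> = (\<Sum>w\<in>verts ?G. h)"
  proof (rule sum.cong[OF refl])
    fix w assume "w \<in> verts ?G"
    then have w: "w \<in> lists A" "length w = N" by auto
    then have "hd w \<in> A" using assms(2) by (cases w) auto
    then show "card (out_arcs ?G w) = h"
      using w assms by (simp add: out_arcs_tuple_digraph card_image inj_on_def)
  qed
  also have "\<dots> = card A ^ N * h"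
    using card_lists_length_eq[OF assms(1), of N] by (simp add: lists_eq_set)
  finally show ?thesis .
qed

text \<open>
  Each arc drops the first entry of a vertex and appends an \<open>R\<close>-successor of that entry. The tuple
  thus works as a queue: after \<open>length xs\<close> arcs the entries \<open>xs\<close> have left at the front and
  their successors \<open>xs'\<close> stand at the end. The part \<open>ys\<close> that is still waiting makes the induction
  possible; for \<open>ys = []\<close> one round replaces every entry by a successor of its own.
\<close>

lemma tuple_digraph_replace_prefix:
  assumes R: "\<And>x y. R x y \<Longrightarrow> x \<in> A \<and> y \<in> A"
    and "list_all2 R xs xs'" and "ys \<in> lists A" and "length (xs @ ys) = N"
  shows "(xs @ ys) \<rightarrow>\<^sup>*\<^bsub>tuple_digraph A R N\<^esub> (ys @ xs')"
  using assms(2-)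
proof (induction xs xs' arbitrary: ys rule: list_all2_induct)
  case Nil
  interpret wf_digraph "tuple_digraph A R N" by (rule wf_tuple_digraph)
  from Nil show ?case by (auto intro: reachable_refl)
next
  case (Cons x xs x' xs')
  interpret wf_digraph "tuple_digraph A R N" by (rule wf_tuple_digraph)
  \<comment> \<open>The arc that moves the first entry to the end, turned into its successor.\<close>
  let ?u = "x # xs @ ys @ [x']"
  have "set xs \<subseteq> A"
    using Cons.hyps(2) by (induction rule: list_all2_induct) (use R in auto)
  then have "?u \<in> arcs (tuple_digraph A R N)"
    using Cons R by auto
  then have "tail (tuple_digraph A R N) ?u \<rightarrow>\<^bsub>tuple_digraph A R N\<^esub> head (tuple_digraph A R N) ?u"
    by (rule in_arcs_imp_in_arcs_ends)
  then have "((x # xs) @ ys) \<rightarrow>\<^bsub>tuple_digraph A R N\<^esub> (xs @ (ys @ [x']))"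
    by (simp add: butlast_append)
  moreover have "(xs @ (ys @ [x'])) \<rightarrow>\<^sup>*\<^bsub>tuple_digraph A R N\<^esub> ((ys @ [x']) @ xs')"
    by (rule Cons.IH) (use Cons R in auto)
  ultimately have "((x # xs) @ ys) \<rightarrow>\<^sup>*\<^bsub>tuple_digraph A R N\<^esub> ((ys @ [x']) @ xs')"
    by (rule adj_reachable_trans)
  then show ?case by simp
qed

text \<open>
  Iterating full rounds: since \<^const>\<open>list_all2\<close> distributes over relational composition, \<open>t\<close> rounds
  realise any entrywise choice of \<open>R\<close>-chains of length \<open>t\<close>.
\<close>

lemma tuple_digraph_reachable_power:
  assumes R: "\<And>x y. R x y \<Longrightarrow> x \<in> A \<and> y \<in> A"
    and "list_all2 (R ^^ t) u v" and "u \<in> lists A" and "length u = N"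
  shows "u \<rightarrow>\<^sup>*\<^bsub>tuple_digraph A R N\<^esub> v"
  using assms(2-)
proof (induction t arbitrary: v)
  case 0
  interpret wf_digraph "tuple_digraph A R N" by (rule wf_tuple_digraph)
  from 0 show ?case by (auto simp: list.rel_eq intro: reachable_refl)
next
  case (Suc t)
  interpret wf_digraph "tuple_digraph A R N" by (rule wf_tuple_digraph)
  from Suc.prems(1) obtain w where w: "list_all2 (R ^^ t) u w" "list_all2 R w v"
    by (auto simp: list.rel_compp)
  from Suc.IH[OF w(1) Suc.prems(2,3)] have "u \<rightarrow>\<^sup>*\<^bsub>tuple_digraph A R N\<^esub> w" .
  also have "w \<rightarrow>\<^sup>*\<^bsub>tuple_digraph A R N\<^esub> v"
    using tuple_digraph_replace_prefix[OF R w(2), of "[]" N] Suc.prems w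
    by (simp add: list_all2_lengthD)
  finally show ?case .
qed

text \<open>
  Connectedness of \<open>R\<close> alone would not suffice in \<open>total\<close>: a round advances all entries
  simultaneously, so their chains must have a common length.
\<close>

lemma tuple_digraph_euler_circuit:
  assumes "finite A" and "A \<noteq> {}" and "N > 0"
    and R: "\<And>x y. R x y \<Longrightarrow> x \<in> A \<and> y \<in> A"
    and out: "\<And>x. x \<in> A \<Longrightarrow> card {y. R x y} = h"
    and "in": "\<And>y. y \<in> A \<Longrightarrow> card {x. R x y} = h"
    and total: "\<And>x y. x \<in> A \<Longrightarrow> y \<in> A \<Longrightarrow> (R ^^ t) x y"
  obtains w p where "pre_digraph.euler_trail (tuple_digraph A R N) w p w"
proof -
  let ?G = "tuple_digraph A R N"
  interpret fin_digraph ?G by (rule fin_tuple_digraph[OF assms(1)])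
  have "connected ?G"
    unfolding connected_def
  proof (rule strongly_connectedI)
    obtain a where "a \<in> A" using assms(2) by auto
    then have "replicate N a \<in> verts ?G" by auto
    then show "verts (mk_symmetric ?G) \<noteq> {}" by auto
  next
    fix u v assume "u \<in> verts (mk_symmetric ?G)" "v \<in> verts (mk_symmetric ?G)"
    then have uv: "u \<in> lists A" "length u = N" "v \<in> lists A" "length v = N" by auto
    then have "list_all2 (R ^^ t) u v"
      by (intro list_all2_all_nthI total) (auto simp: lists_eq_set)
    then show "u \<rightarrow>\<^sup>*\<^bsub>mk_symmetric ?G\<^esub> v"
      using uv by (intro reachable_mk_symmetricI tuple_digraph_reachable_power[OF R])
  qed
  moreover have "in_degree ?G w = out_degree ?G w" if "w \<in> verts ?G" for w
  proof -
    have w: "w \<in> lists A" "length w = N" "w \<noteq> []" using that assms(3) by auto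
    then have "hd w \<in> A" "last w \<in> A" by (auto simp: lists_eq_set)
    then show ?thesis
      using w assms(3) R out "in"
      by (simp add: in_degree_def out_degree_def in_arcs_tuple_digraph out_arcs_tuple_digraph
          card_image inj_on_def)
  qed
  ultimately show thesis using closed_euler that by blast
qed

section \<open>From circuits to sequences\<close>

text \<open>
  Tuples that overlap like consecutive windows are determined by their first entries, because the
  \<open>j\<close>-th entry moves to the front in \<open>j\<close> shifts.
\<close>

lemma nth_eq_hd_shifted:
  assumes "\<And>i. length (W i) = n" and "\<And>i. tl (W i) = butlast (W (Suc i))"
    and "j < n"
  shows "W i ! j = hd (W (i + j))"
  using assms(3)
proof (induction j arbitrary: i)
  case 0
  then have "W i \<noteq> []" using assms(1)[of i] by auto
  then show ?case by (simp add: hd_conv_nth)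
next
  case (Suc j)
  have "W i ! Suc j = tl (W i) ! j" using Suc.prems assms(1)[of i] by (simp add: nth_tl)
  also have "\<dots> = W (Suc i) ! j"
    using Suc.prems assms(1)[of "Suc i"] by (simp add: assms(2) nth_butlast)
  finally show ?case using Suc by simp
qed

lemma (in wf_digraph) closed_awalk_head_eq_tail:
  assumes "awalk u p u" and "i < length p"
  shows "head G (p ! i) = tail G (p ! (Suc i mod length p))"
proof -
  from assms(1) have cas: "cas u p u" and last: "awlast u p = u" by auto
  have ne: "p \<noteq> []" using assms(2) by auto
  \<comment> \<open>The vertices of the walk, listed once by the tails and once by the heads of its arcs.\<close>
  have eq: "map (tail G) p @ [head G (last p)] = tail G (hd p) # map (head G) p"
    using awalk_verts_conv[of u p] awalk_verts_conv'[OF cas] ne by simp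
  have "head G (p ! i) = (tail G (hd p) # map (head G) p) ! Suc i"
    using assms(2) by simp
  also have "\<dots> = (map (tail G) p @ [head G (last p)]) ! Suc i"
    by (simp only: eq)
  finally have step: "head G (p ! i) = (map (tail G) p @ [head G (last p)]) ! Suc i" .
  show ?thesis
  proof (cases "Suc i = length p")
    case True
    then have "head G (p ! i) = u"
      using step last ne by (simp add: awalk_verts_conv nth_append)
    moreover have "tail G (hd p) = u" using cas ne by (simp add: cas_simp)
    ultimately show ?thesis using True ne by (simp add: hd_conv_nth)
  next
    case False
    then show ?thesis using step assms(2) by (simp add: nth_append)
  qed
qed

text \<open>
  The sequence reads off the first entry of each arc of an Euler circuit. Its windows are then the
  arcs themselves. They repeat only with the period because the circuit uses no arc twice, the
  period is the number of arcs because it uses all of them, and no window is a reversed window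
  because reversal exchanges the ends of a tuple while \<open>R\<close> is asymmetric.
\<close>

lemma orientable_sequence_of_relation:
  fixes R :: "nat \<Rightarrow> nat \<Rightarrow> bool"
  assumes "n \<ge> 2" and "k > 0" and "h > 0"
    and R: "\<And>x y. R x y \<Longrightarrow> x < k \<and> y < k"
    and asym: "\<And>x y. R x y \<Longrightarrow> \<not> R y x"
    and out: "\<And>x. x < k \<Longrightarrow> card {y. R x y} = h"
    and "in": "\<And>y. y < k \<Longrightarrow> card {x. R x y} = h"
    and total: "\<And>x y. x < k \<Longrightarrow> y < k \<Longrightarrow> (R ^^ t) x y"
  shows "\<exists>s. orientable_sequence k n (k ^ (n - 1) * h) s"
proof -
  let ?G = "tuple_digraph {..<k} R (n - 1)"
  interpret fin_digraph ?G by (rule fin_tuple_digraph) simp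
  obtain w p where euler: "euler_trail w p w"
    by (rule tuple_digraph_euler_circuit[of "{..<k}" "n - 1" R h t])
       (use assms in \<open>auto simp: lessThan_empty_iff\<close>)
  then have walk: "awalk w p w" and dist: "distinct p" and set_p: "set p = arcs ?G"
    by (simp_all only: euler_trail_def trail_def)
  define m where "m = length p"
  have m: "m = k ^ (n - 1) * h"
    using distinct_card[OF dist] set_p card_arcs_tuple_digraph[of "{..<k}" "n - 1" R h] assms
    by (simp add: m_def)
  then have "m > 0" using assms by simp
  define W where "W i = p ! (i mod m)" for i
  have W_arc: "W i \<in> arcs ?G" for i
    using \<open>m > 0\<close> set_p nth_mem[of "i mod m" p] unfolding W_def m_def by (metis mod_less_divisor)
  then have len: "length (W i) = n" and R_ends: "R (hd (W i)) (last (W i))" for i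
    using W_arc[of i] assms(1) by auto
  have shift: "tl (W i) = butlast (W (Suc i))" for i
    using closed_awalk_head_eq_tail[OF walk, of "i mod m"] \<open>m > 0\<close>
    by (simp add: W_def m_def mod_Suc_eq)
  define s where "s i = hd (W i)" for i
  have window: "window s n i = W i" for i
    by (rule nth_equalityI)
       (auto simp: window_def len s_def nth_eq_hd_shifted[of W n, OF len shift])
  have "window_sequence k n m s"
    unfolding window_sequence_def periodic_with_def
  proof (intro conjI allI impI)
    show "s i < k" for i using R R_ends by (auto simp: s_def)
    show "s (i + m) = s i" for i by (simp add: s_def W_def)
    fix i j assume "window s n i = window s n j"
    then show "[i = j] (mod m)"
      using dist \<open>m > 0\<close> by (simp add: window W_def m_def nth_eq_iff_index_eq cong_def)
  qed fact
  moreover have "window s n i \<noteq> rev (window s n j)" for i j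
  proof
    assume "window s n i = rev (window s n j)"
    then have "hd (W i) = last (W j)" "last (W i) = hd (W j)"
      using window by (simp_all add: hd_rev last_rev)
    then show False using R_ends[of i] R_ends[of j] asym by auto
  qed
  ultimately show ?thesis unfolding orientable_sequence_def m by blast
qed

section \<open>Forward steps in a residue ring\<close>

definition forward_step :: "nat \<Rightarrow> nat \<Rightarrow> nat \<Rightarrow> nat \<Rightarrow> bool" where
  "forward_step k h x y \<longleftrightarrow> x < k \<and> y < k \<and> (\<exists>d\<in>{1..h}. [y = x + d] (mod k))"

text \<open>Two forward steps that undo each other would add up to a multiple of \<open>k\<close> in $\{2,\ldots,2h\}$.\<close>

lemma forward_step_asym:
  assumes "2 * h < k" and "forward_step k h x y"
  shows "\<not> forward_step k h y x"
proof
  assume "forward_step k h y x"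
  with assms(2) obtain d e where de: "d \<in> {1..h}" "e \<in> {1..h}"
    "[y = x + d] (mod k)" "[x = y + e] (mod k)" by (auto simp: forward_step_def)
  have "[y + e = x + d + e] (mod k)" using de(3) by (intro cong_add) auto
  with de(4) have "[x = x + (d + e)] (mod k)" by (metis add.assoc cong_trans)
  then have "k dvd d + e" using cong_sym cong_add_lcancel_0_nat cong_0_iff by blast
  then show False using de(1,2) assms(1) by (auto dest: dvd_imp_le)
qed

lemma card_forward_step_successors:
  assumes "h < k" and "x < k"
  shows "card {y. forward_step k h x y} = h"
proof -
  have "{y. forward_step k h x y} = (\<lambda>d. (x + d) mod k) ` {1..h}"
    using assms by (auto simp: forward_step_def cong_def)
  moreover have "inj_on (\<lambda>d. (x + d) mod k) {1..h}"
  proof (rule inj_onI)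
    fix d e assume de: "d \<in> {1..h}" "e \<in> {1..h}" "(x + d) mod k = (x + e) mod k"
    then have "[d = e] (mod k)" using cong_add_lcancel_nat unfolding cong_def by metis
    then show "d = e" using de assms by (auto simp: cong_def)
  qed
  ultimately show ?thesis by (simp add: card_image)
qed

text \<open>
  The reflection $x \mapsto k - 1 - x$ reverses forward steps and so carries the predecessors of \<open>y\<close>
  to the successors of its mirror image.
\<close>

lemma card_forward_step_predecessors:
  assumes "h < k" and "y < k"
  shows "card {x. forward_step k h x y} = h"
proof -
  let ?r = "\<lambda>x. k - 1 - x"
  have reflect: "forward_step k h (?r y) (?r x)" if "forward_step k h x y" for x y
  proof -
    from that obtain d where d: "x < k" "y < k" "d \<in> {1..h}" "[y = x + d] (mod k)"
      by (auto simp: forward_step_def)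
    \<comment> \<open>Adding \<open>x + y\<close> to both sides avoids truncated subtraction.\<close>
    have "[?r x + (x + y) = ?r y + d + (x + y)] (mod k)"
    proof -
      have "?r x + (x + y) = k - 1 + y" "?r y + d + (x + y) = k - 1 + (x + d)"
        using d(1,2) by auto
      then show ?thesis using d(4) by (simp only: cong_add_lcancel_nat)
    qed
    then have "[?r x = ?r y + d] (mod k)" by (simp only: cong_add_rcancel_nat)
    then show ?thesis using d by (auto simp: forward_step_def)
  qed
  have "bij_betw ?r {x. forward_step k h x y} {z. forward_step k h (?r y) z}"
  proof (rule bij_betw_byWitness[where f' = ?r])
    show "?r ` {x. forward_step k h x y} \<subseteq> {z. forward_step k h (?r y) z}"
      using reflect by blast
    have "forward_step k h (?r z) y" if "forward_step k h (?r y) z" for z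
      using reflect[OF that] assms(2) by simp
    then show "?r ` {z. forward_step k h (?r y) z} \<subseteq> {x. forward_step k h x y}"
      by blast
  qed (auto simp: forward_step_def)
  then have "card {x. forward_step k h x y} = card {z. forward_step k h (?r y) z}"
    by (rule bij_betw_same_card)
  also have "\<dots> = h" using assms by (intro card_forward_step_successors) auto
  finally show ?thesis .
qed

text \<open>
  Steps of length 1 and 2 suffice: \<open>c\<close> of the \<open>t\<close> steps have length 2, so the total advance is
  \<open>t + c\<close>.
\<close>

lemma forward_step_power:
  assumes "2 \<le> h" and "x < k" and "c \<le> t"
  shows "(forward_step k h ^^ t) x ((x + t + c) mod k)"
  using assms(3)
proof (induction t arbitrary: c)
  case 0
  then show ?case using assms by simp
next
  case (Suc t)
  \<comment> \<open>The last step is a long one only if every step has to be.\<close>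
  define d :: nat where "d = (if c = Suc t then 2 else 1)"
  define c' where "c' = (if c = Suc t then t else c)"
  have c': "c' \<le> t" "x + Suc t + c = x + t + c' + d"
    using Suc.prems by (auto simp: c'_def d_def)
  have "[(x + Suc t + c) mod k = (x + t + c') mod k + d] (mod k)"
    unfolding c'(2) by (simp add: cong_def mod_simps)
  then have "forward_step k h ((x + t + c') mod k) ((x + Suc t + c) mod k)"
    unfolding forward_step_def using assms(1,2)
    by (intro conjI bexI[of _ d]) (auto simp: d_def)
  with Suc.IH[OF c'(1)] show ?case by auto
qed

lemma forward_step_power_total:
  assumes "2 \<le> h" and "x < k" and "y < k"
  shows "(forward_step k h ^^ k) x y"
proof -
  define c where "c = (if x \<le> y then y - x else y + k - x)"
  have "c \<le> k" "(x + k + c) mod k = y"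
    using assms(2,3) by (auto simp: c_def)
  then show ?thesis using forward_step_power[OF assms(1,2), of c k] by simp
qed

theorem corollary4p6:
  fixes n k :: nat
  assumes "n \<ge> 2" and "k \<ge> 5"
  shows "\<exists>s. orientable_sequence k n (k ^ (n - 1) * ((k - 1) div 2)) s"
proof -
  define h where "h = (k - 1) div 2"
  have h: "2 \<le> h" "2 * h < k" using assms(2) by (auto simp: h_def)
  have "\<exists>s. orientable_sequence k n (k ^ (n - 1) * h) s"
  proof (rule orientable_sequence_of_relation[where R = "forward_step k h" and t = k])
    show "forward_step k h x y \<Longrightarrow> x < k \<and> y < k" for x y
      by (simp add: forward_step_def)
    show "forward_step k h x y \<Longrightarrow> \<not> forward_step k h y x" for x y
      using h(2) by (rule forward_step_asym)
  qed (use assms h in \<open>auto intro: card_forward_step_successors card_forward_step_predecessors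
        forward_step_power_total\<close>)
  then show ?thesis by (simp add: h_def)
qed

end
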